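(* Assume that $\vec u$, $\vec v$ are $\omega$-Fraïssé sequences in a given category $\mathfrak K$. Assume further that $k,\ell<\omega$ and $f\colon u_k\to v_\ell$ is an arrow in $\mathfrak K$. Then there exists an isomorphism of sequences $F\colon\vec u\to\vec v$ such that $$F\circ u_k^\infty=v_\ell^\infty\circ f.$$ In particular, $\vec u$ and $\vec v$ are isomorphic.
   Context: $\mathfrak K(a,b)$ is the set of arrows from $a$ to $b$. An inductive sequence of length $\delta$ ($\delta>0$ an ordinal) in $\mathfrak K$ is a functor $\vec a\colon\delta\to\mathfrak K$, with objects $a_\xi$ and bonding arrows $a_\xi^\eta\colon a_\xi\to a_\eta$ ($\xi\leq\eta<\delta$). An $\omega$-Fraïssé sequence in $\mathfrak K$ is an inductive sequence $\vec u$ of length $\omega$ such that (U) for every object $x$ there is $n<\omega$ with $\mathfrak K(x,u_n)\neq\emptyset$; (A) for every $n<\omega$ and every arrow $g\colon u_n\to y$ there are $m\geq n$ and $h\colon y\to u_m$ with $u_n^m=h\circ g$. A transformation $\vec a\to\vec b$ of sequences (of lengths $\lambda,\rho$) is a pair consisting of an order preserving $\varphi\colon\lambda\to\rho$ and a natural transformation $F\colon\vec a\to\vec b\circ\varphi$, i.e. arrows $F(\alpha)\colon a_\alpha\to b_{\varphi(\alpha)}$ with $F(\beta)\circ a_\alpha^\beta=b_{\varphi(\alpha)}^{\varphi(\beta)}\circ F(\alpha)$. Transformations $(\varphi,F)$, $(\psi,G)$ are equivalent if for every $\alpha<\lambda$ there is $\gamma\geq\varphi(\alpha),\psi(\alpha)$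 with $b_{\varphi(\alpha)}^\gamma\circ F(\alpha)=b_{\psi(\alpha)}^\gamma\circ G(\alpha)$. Arrows of sequences are equivalence classes of transformations, composed in the obvious way; an isomorphism of sequences is an invertible arrow in the resulting category. An object of $\mathfrak K$ is identified with a sequence of length $1$, and $u_k^\infty\colon u_k\to\vec u$ denotes the arrow represented by $\mathrm{id}_{u_k}$ at index $k$. *)

theory Defs
  imports Main
begin

record ('o, 'm) cat =
  Obj  :: "'o set"
  Arr  :: "'m set"
  Dom  :: "'m \<Rightarrow> 'o"
  Cod  :: "'m \<Rightarrow> 'o"
  Ide  :: "'o \<Rightarrow> 'm"
  Comp :: "'m \<Rightarrow> 'm \<Rightarrow> 'm"  (infixl "\<cdot>\<index>" 70)

definition Hom :: "('o, 'm, 'z) cat_scheme \<Rightarrow> 'o \<Rightarrow> 'o \<Rightarrow> 'm set" where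
  "Hom K x y = {f \<in> Arr K. Dom K f = x \<and> Cod K f = y}"

locale category =
  fixes K :: "('o, 'm, 'z) cat_scheme" (structure)
  assumes dom_obj: "f \<in> Arr K \<Longrightarrow> Dom K f \<in> Obj K"
    and cod_obj: "f \<in> Arr K \<Longrightarrow> Cod K f \<in> Obj K"
    and ide_hom: "x \<in> Obj K \<Longrightarrow> Ide K x \<in> Hom K x x"
    and comp_hom: "\<lbrakk>f \<in> Hom K x y; g \<in> Hom K y z\<rbrakk> \<Longrightarrow> g \<cdot> f \<in> Hom K x z"
    and comp_ide_right: "f \<in> Hom K x y \<Longrightarrow> f \<cdot> Ide K x = f"
    and comp_ide_left: "f \<in> Hom K x y \<Longrightarrow> Ide K y \<cdot> f = f"
    and comp_assoc:
      "\<lbrakk>f \<in> Hom K w x; g \<in> Hom K x y; h \<in> Hom K y z\<rbrakk> \<Longrightarrow> h \<cdot> (g \<cdot> f) = (h \<cdot> g) \<cdot> f"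

definition is_iso :: "('o, 'm, 'z) cat_scheme \<Rightarrow> 'm \<Rightarrow> bool" where
  "is_iso K f \<longleftrightarrow> f \<in> Arr K \<and>
     (\<exists>g \<in> Hom K (Cod K f) (Dom K f).
        g \<cdot>\<^bsub>K\<^esub> f = Ide K (Dom K f) \<and> f \<cdot>\<^bsub>K\<^esub> g = Ide K (Cod K f))"

definition isomorphic :: "('o, 'm, 'z) cat_scheme \<Rightarrow> 'o \<Rightarrow> 'o \<Rightarrow> bool" where
  "isomorphic K x y \<longleftrightarrow> (\<exists>f \<in> Hom K x y. is_iso K f)"

text \<open>
  The length of a sequence, an ordinal \<open>\<delta> > 0\<close>, is represented by a nonempty initial
  segment \<open>idx\<close> of a well-ordered type \<open>'i\<close>. For \<open>'i = nat\<close> the available lengths are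
  exactly \<open>1, 2, \<dots>\<close> and \<open>\<omega>\<close>, the latter being \<open>idx = UNIV\<close>. The values of \<open>ob\<close> outside
  \<open>idx\<close>, and those of \<open>bond i j\<close> unless \<open>i \<le> j\<close> are both in \<open>idx\<close>, are irrelevant.
\<close>

record ('i, 'o, 'm) sequence =
  idx  :: "'i set"
  ob   :: "'i \<Rightarrow> 'o"
  bond :: "'i \<Rightarrow> 'i \<Rightarrow> 'm"

definition inductive_sequence ::
    "('o, 'm) cat \<Rightarrow> ('i::wellorder, 'o, 'm) sequence \<Rightarrow> bool" where
  "inductive_sequence K a \<longleftrightarrow>
     idx a \<noteq> {} \<and> (\<forall>i \<in> idx a. \<forall>j \<le> i. j \<in> idx a) \<and>
     (\<forall>i \<in> idx a. ob a i \<in> Obj K) \<and>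
     (\<forall>i \<in> idx a. \<forall>j \<in> idx a. i \<le> j \<longrightarrow> bond a i j \<in> Hom K (ob a i) (ob a j)) \<and>
     (\<forall>i \<in> idx a. bond a i i = Ide K (ob a i)) \<and>
     (\<forall>i \<in> idx a. \<forall>j \<in> idx a. \<forall>k \<in> idx a. i \<le> j \<longrightarrow> j \<le> k \<longrightarrow>
        bond a j k \<cdot>\<^bsub>K\<^esub> bond a i j = bond a i k)"

definition omega_fraisse :: "('o, 'm) cat \<Rightarrow> (nat, 'o, 'm) sequence \<Rightarrow> bool" where
  "omega_fraisse K u \<longleftrightarrow>
     inductive_sequence K u \<and> idx u = UNIV \<and>
     (\<forall>x \<in> Obj K. \<exists>n. Hom K x (ob u n) \<noteq> {}) \<and>
     (\<forall>n y. \<forall>g \<in> Hom K (ob u n) y.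
        \<exists>m \<ge> n. \<exists>h \<in> Hom K y (ob u m). bond u n m = h \<cdot>\<^bsub>K\<^esub> g)"

type_synonym ('i, 'm) pretrans = "('i \<Rightarrow> 'i) \<times> ('i \<Rightarrow> 'm)"

fun transformation :: "('o, 'm) cat \<Rightarrow> ('i::wellorder, 'o, 'm) sequence \<Rightarrow>
    ('i, 'o, 'm) sequence \<Rightarrow> ('i, 'm) pretrans \<Rightarrow> bool" where
  "transformation K a b (\<phi>, F) \<longleftrightarrow>
     \<phi> ` idx a \<subseteq> idx b \<and> mono_on (idx a) \<phi> \<and>
     (\<forall>i \<in> idx a. F i \<in> Hom K (ob a i) (ob b (\<phi> i))) \<and>
     (\<forall>i \<in> idx a. \<forall>j \<in> idx a. i \<le> j \<longrightarrow>
        F j \<cdot>\<^bsub>K\<^esub> bond a i j = bond b (\<phi> i) (\<phi> j) \<cdot>\<^bsub>K\<^esub> F i)"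

fun pretrans_eq :: "('o, 'm) cat \<Rightarrow> ('i::wellorder, 'o, 'm) sequence \<Rightarrow>
    ('i, 'o, 'm) sequence \<Rightarrow> ('i, 'm) pretrans \<Rightarrow> ('i, 'm) pretrans \<Rightarrow> bool" where
  "pretrans_eq K a b (\<phi>, F) (\<psi>, G) \<longleftrightarrow>
     (\<forall>i \<in> idx a. \<exists>c \<in> idx b. \<phi> i \<le> c \<and> \<psi> i \<le> c \<and>
        bond b (\<phi> i) c \<cdot>\<^bsub>K\<^esub> F i = bond b (\<psi> i) c \<cdot>\<^bsub>K\<^esub> G i)"

definition trans_rel :: "('o, 'm) cat \<Rightarrow> ('i::wellorder, 'o, 'm) sequence \<Rightarrow>
    ('i, 'o, 'm) sequence \<Rightarrow> ('i, 'm) pretrans rel" where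
  "trans_rel K a b =
     {(s, t). transformation K a b s \<and> transformation K a b t \<and> pretrans_eq K a b s t}"

fun trans_comp :: "('o, 'm) cat \<Rightarrow>
    ('i, 'm) pretrans \<Rightarrow> ('i, 'm) pretrans \<Rightarrow> ('i, 'm) pretrans" where
  "trans_comp K (\<psi>, G) (\<phi>, F) = (\<psi> \<circ> \<phi>, \<lambda>i. G (\<phi> i) \<cdot>\<^bsub>K\<^esub> F i)"

text \<open>
  An arrow of sequences is recorded as \<open>(a, b, X)\<close> with source \<open>a\<close>, target \<open>b\<close> and an
  equivalence class \<open>X\<close> of transformations from \<open>a\<close> to \<open>b\<close>.
\<close>

type_synonym ('i, 'o, 'm) seq_arrow =
  "('i, 'o, 'm) sequence \<times> ('i, 'o, 'm) sequence \<times> ('i, 'm) pretrans set"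

definition arrow_of :: "('o, 'm) cat \<Rightarrow> ('i::wellorder, 'o, 'm) sequence \<Rightarrow>
    ('i, 'o, 'm) sequence \<Rightarrow> ('i, 'm) pretrans \<Rightarrow> ('i, 'o, 'm) seq_arrow" where
  "arrow_of K a b s = (a, b, trans_rel K a b `` {s})"

definition Seq :: "('o, 'm) cat \<Rightarrow>
    (('i::wellorder, 'o, 'm) sequence, ('i, 'o, 'm) seq_arrow) cat" where
  "Seq K = \<lparr>
     Obj = {a. inductive_sequence K a},
     Arr = {(a, b, X). inductive_sequence K a \<and> inductive_sequence K b \<and>
              X \<in> {s. transformation K a b s} // trans_rel K a b},
     Dom = (\<lambda>(a, b, X). a),
     Cod = (\<lambda>(a, b, X). b),
     Ide = (\<lambda>a. arrow_of K a a (\<lambda>i. i, \<lambda>i. Ide K (ob a i))),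
     Comp = (\<lambda>(b', c, Y) (a, b, X).
              (a, c, \<Union>t \<in> Y. \<Union>s \<in> X. trans_rel K a c `` {trans_comp K t s}))\<rparr>"

text \<open>An object as a sequence of length 1, and an arrow between objects as an arrow
  between such sequences.\<close>

definition obj_seq :: "('o, 'm) cat \<Rightarrow> 'o \<Rightarrow> ('i::wellorder, 'o, 'm) sequence" where
  "obj_seq K x = \<lparr>idx = {LEAST i. True}, ob = (\<lambda>_. x), bond = (\<lambda>_ _. Ide K x)\<rparr>"

definition arr_seq :: "('o, 'm) cat \<Rightarrow> 'm \<Rightarrow> ('i::wellorder, 'o, 'm) seq_arrow" where
  "arr_seq K f = arrow_of K (obj_seq K (Dom K f)) (obj_seq K (Cod K f)) (\<lambda>i. i, \<lambda>_. f)"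

text \<open>The arrow \<open>u\<^sub>k\<^sup>\<infinity>\<close> from \<open>u\<^sub>k\<close> to \<open>u\<close>.\<close>

definition seq_inj ::
    "('o, 'm) cat \<Rightarrow> ('i::wellorder, 'o, 'm) sequence \<Rightarrow> 'i \<Rightarrow> ('i, 'o, 'm) seq_arrow" where
  "seq_inj K u k = arrow_of K (obj_seq K (ob u k)) u (\<lambda>_. k, \<lambda>_. Ide K (ob u k))"

lemma HomD:
  assumes "f \<in> Hom K x y"
  shows "f \<in> Arr K" "Dom K f = x" "Cod K f = y"
  using assms by (auto simp: Hom_def)

lemma bond_hom:
  assumes "inductive_sequence K a" "i \<in> idx a" "j \<in> idx a" "i \<le> j"
  shows "bond a i j \<in> Hom K (ob a i) (ob a j)"
  using assms unfolding inductive_sequence_def by blast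

lemma bond_comp:
  assumes "inductive_sequence K a" "i \<in> idx a" "j \<in> idx a" "k \<in> idx a" "i \<le> j" "j \<le> k"
  shows "bond a j k \<cdot>\<^bsub>K\<^esub> bond a i j = bond a i k"
  using assms unfolding inductive_sequence_def by blast

lemma bond_refl:
  assumes "inductive_sequence K a" "i \<in> idx a"
  shows "bond a i i = Ide K (ob a i)"
  using assms unfolding inductive_sequence_def by blast

lemma seq_obj:
  assumes "inductive_sequence K a" "i \<in> idx a"
  shows "ob a i \<in> Obj K"
  using assms by (simp add: inductive_sequence_def)

lemma transD:
  assumes "transformation K a b (p, F)" "i \<in> idx a"
  shows "p i \<in> idx b" "F i \<in> Hom K (ob a i) (ob b (p i))"
  using assms by auto

lemma trans_mono:
  assumes "transformation K a b (p, F)" "i \<in> idx a" "j \<in> idx a" "i \<le> j"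
  shows "p i \<le> p j"
  using assms by (auto simp: mono_on_def)

lemma trans_nat:
  assumes "transformation K a b (p, F)" "i \<in> idx a" "j \<in> idx a" "i \<le> j"
  shows "F j \<cdot>\<^bsub>K\<^esub> bond a i j = bond b (p i) (p j) \<cdot>\<^bsub>K\<^esub> F i"
  using assms by auto

context
  fixes K :: "('o, 'm) cat"
  assumes cat: "category K"
begin

interpretation category K by (fact cat)

lemma bond_bond_comp:
  assumes "inductive_sequence K b" "f \<in> Hom K x (ob b i)" "i \<in> idx b" "j \<in> idx b" "k \<in> idx b"
    "i \<le> j" "j \<le> k"
  shows "bond b j k \<cdot>\<^bsub>K\<^esub> (bond b i j \<cdot>\<^bsub>K\<^esub> f) = bond b i k \<cdot>\<^bsub>K\<^esub> f"
  using assms comp_assoc[OF assms(2) bond_hom bond_hom] bond_comp[of K b i j k] by simp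

lemma bond_eq_mono:
  assumes b: "inductive_sequence K b"
    and f: "f \<in> Hom K x (ob b i)" and g: "g \<in> Hom K x (ob b j)"
    and idx: "i \<in> idx b" "j \<in> idx b" "c \<in> idx b" "d \<in> idx b"
    and le: "i \<le> c" "j \<le> c" "c \<le> d"
    and eq: "bond b i c \<cdot>\<^bsub>K\<^esub> f = bond b j c \<cdot>\<^bsub>K\<^esub> g"
  shows "bond b i d \<cdot>\<^bsub>K\<^esub> f = bond b j d \<cdot>\<^bsub>K\<^esub> g"
  using bond_bond_comp[OF b f idx(1,3,4) le(1,3)] bond_bond_comp[OF b g idx(2,3,4) le(2,3)] eq
  by simp

lemma pretrans_eq_refl:
  assumes "inductive_sequence K b" "transformation K a b s"
  shows "pretrans_eq K a b s s"
  using assms by (cases s) auto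

lemma pretrans_eq_sym: "pretrans_eq K a b s t \<Longrightarrow> pretrans_eq K a b t s"
  by (cases s; cases t) force

lemma pretrans_eq_trans:
  assumes b: "inductive_sequence K b"
    and s: "transformation K a b s" and t: "transformation K a b t" and r: "transformation K a b r"
    and st: "pretrans_eq K a b s t" and tr: "pretrans_eq K a b t r"
  shows "pretrans_eq K a b s r"
proof -
  obtain p F q G w H where eqs: "s = (p, F)" "t = (q, G)" "r = (w, H)"
    by (metis surj_pair)
  have "\<exists>c\<in>idx b. p i \<le> c \<and> w i \<le> c \<and>
      bond b (p i) c \<cdot>\<^bsub>K\<^esub> F i = bond b (w i) c \<cdot>\<^bsub>K\<^esub> H i" if i: "i \<in> idx a" for i
  proof -
    obtain c where c: "c \<in> idx b" "p i \<le> c" "q i \<le> c"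
      "bond b (p i) c \<cdot>\<^bsub>K\<^esub> F i = bond b (q i) c \<cdot>\<^bsub>K\<^esub> G i"
      using st i eqs by auto
    obtain d where d: "d \<in> idx b" "q i \<le> d" "w i \<le> d"
      "bond b (q i) d \<cdot>\<^bsub>K\<^esub> G i = bond b (w i) d \<cdot>\<^bsub>K\<^esub> H i"
      using tr i eqs by auto
    have e: "max c d \<in> idx b" using c d by (auto simp: max_def)
    have F: "F i \<in> Hom K (ob a i) (ob b (p i))" "p i \<in> idx b"
      and G: "G i \<in> Hom K (ob a i) (ob b (q i))" "q i \<in> idx b"
      and H: "H i \<in> Hom K (ob a i) (ob b (w i))" "w i \<in> idx b"
      using s t r i eqs by auto
    have "bond b (p i) (max c d) \<cdot>\<^bsub>K\<^esub> F i = bond b (q i) (max c d) \<cdot>\<^bsub>K\<^esub> G i"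
      by (rule bond_eq_mono[OF b F(1) G(1) F(2) G(2) c(1) e c(2,3) _ c(4)]) simp
    moreover have "bond b (q i) (max c d) \<cdot>\<^bsub>K\<^esub> G i = bond b (w i) (max c d) \<cdot>\<^bsub>K\<^esub> H i"
      by (rule bond_eq_mono[OF b G(1) H(1) G(2) H(2) d(1) e d(2,3) _ d(4)]) simp
    ultimately show ?thesis
      using c(2) d(3) e by (intro bexI[of _ "max c d"]) (auto simp: le_max_iff_disj)
  qed
  then show ?thesis using eqs by simp
qed

lemma equiv_trans_rel:
  assumes "inductive_sequence K b"
  shows "equiv {s. transformation K a b s} (trans_rel K a b)"
proof (rule equivI)
  show "refl_on {s. transformation K a b s} (trans_rel K a b)"
    using pretrans_eq_refl[OF assms] by (auto simp: refl_on_def trans_rel_def)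
  show "sym (trans_rel K a b)"
    unfolding sym_def trans_rel_def using pretrans_eq_sym by blast
  show "trans (trans_rel K a b)"
    unfolding trans_def trans_rel_def using pretrans_eq_trans[OF assms] by blast
  show "trans_rel K a b \<subseteq> {s. transformation K a b s} \<times> {s. transformation K a b s}"
    by (auto simp: trans_rel_def)
qed

lemma transformation_comp:
  assumes a: "inductive_sequence K a" and b: "inductive_sequence K b"
    and c: "inductive_sequence K c"
    and s: "transformation K a b s" and t: "transformation K b c t"
  shows "transformation K a c (trans_comp K t s)"
proof -
  obtain p F q G where eqs: "s = (p, F)" "t = (q, G)"
    by (metis surj_pair)
  note s' = s[unfolded eqs] and t' = t[unfolded eqs]
  have "(G (p j) \<cdot>\<^bsub>K\<^esub> F j) \<cdot>\<^bsub>K\<^esub> bond a i j = bond c (q (p i)) (q (p j)) \<cdot>\<^bsub>K\<^esub> (G (p i) \<cdot>\<^bsub>K\<^esub> F i)"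
    if ij: "i \<in> idx a" "j \<in> idx a" "i \<le> j" for i j
  proof -
    note pi = transD[OF s' ij(1)] and pj = transD[OF s' ij(2)]
    note qi = transD[OF t' pi(1)] and qj = transD[OF t' pj(1)]
    note pij = trans_mono[OF s' ij]
    note qij = trans_mono[OF t' pi(1) pj(1) pij]
    have "(G (p j) \<cdot>\<^bsub>K\<^esub> F j) \<cdot>\<^bsub>K\<^esub> bond a i j = G (p j) \<cdot>\<^bsub>K\<^esub> (F j \<cdot>\<^bsub>K\<^esub> bond a i j)"
      using comp_assoc[OF bond_hom[OF a ij] pj(2) qj(2)] by simp
    also have "\<dots> = G (p j) \<cdot>\<^bsub>K\<^esub> (bond b (p i) (p j) \<cdot>\<^bsub>K\<^esub> F i)"
      using trans_nat[OF s' ij] by simp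
    also have "\<dots> = (G (p j) \<cdot>\<^bsub>K\<^esub> bond b (p i) (p j)) \<cdot>\<^bsub>K\<^esub> F i"
      by (rule comp_assoc[OF pi(2) bond_hom[OF b pi(1) pj(1) pij] qj(2)])
    also have "\<dots> = (bond c (q (p i)) (q (p j)) \<cdot>\<^bsub>K\<^esub> G (p i)) \<cdot>\<^bsub>K\<^esub> F i"
      using trans_nat[OF t' pi(1) pj(1) pij] by simp
    also have "\<dots> = bond c (q (p i)) (q (p j)) \<cdot>\<^bsub>K\<^esub> (G (p i) \<cdot>\<^bsub>K\<^esub> F i)"
      using comp_assoc[OF pi(2) qi(2) bond_hom[OF c qi(1) qj(1) qij]] by simp
    finally show ?thesis .
  qed
  moreover have "mono_on (idx a) (q \<circ> p)"
    using trans_mono[OF s'] trans_mono[OF t'] transD(1)[OF s'] by (auto intro!: mono_onI)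
  moreover have "G (p i) \<cdot>\<^bsub>K\<^esub> F i \<in> Hom K (ob a i) (ob c (q (p i)))" if "i \<in> idx a" for i
    using comp_hom[OF transD(2)[OF s' that] transD(2)[OF t' transD(1)[OF s' that]]] .
  ultimately show ?thesis
    using transD(1)[OF s'] transD(1)[OF t'] eqs by auto
qed

lemma trans_comp_cong:
  assumes a: "inductive_sequence K a" and b: "inductive_sequence K b"
    and c: "inductive_sequence K c"
    and s: "(s, s') \<in> trans_rel K a b" and t: "(t, t') \<in> trans_rel K b c"
  shows "(trans_comp K t s, trans_comp K t' s') \<in> trans_rel K a c"
proof -
  obtain p F q G p' F' q' G' where eqs: "s = (p, F)" "t = (q, G)" "s' = (p', F')" "t' = (q', G')"
    by (metis surj_pair)
  have ts: "transformation K a b (p, F)" "transformation K a b (p', F')"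
    and tt: "transformation K b c (q, G)" "transformation K b c (q', G')"
    using s t eqs by (auto simp only: trans_rel_def mem_Collect_eq split_conv)
  have "\<exists>e\<in>idx c. q (p i) \<le> e \<and> q' (p' i) \<le> e \<and>
      bond c (q (p i)) e \<cdot>\<^bsub>K\<^esub> (G (p i) \<cdot>\<^bsub>K\<^esub> F i) = bond c (q' (p' i)) e \<cdot>\<^bsub>K\<^esub> (G' (p' i) \<cdot>\<^bsub>K\<^esub> F' i)"
    if i: "i \<in> idx a" for i
  proof -
    obtain d where d: "d \<in> idx b" "p i \<le> d" "p' i \<le> d"
      "bond b (p i) d \<cdot>\<^bsub>K\<^esub> F i = bond b (p' i) d \<cdot>\<^bsub>K\<^esub> F' i"
      using s i eqs by (auto simp: trans_rel_def)
    obtain e where e: "e \<in> idx c" "q d \<le> e" "q' d \<le> e"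
      "bond c (q d) e \<cdot>\<^bsub>K\<^esub> G d = bond c (q' d) e \<cdot>\<^bsub>K\<^esub> G' d"
      using t d(1) eqs by (auto simp: trans_rel_def)
    have step: "bond c (Q (P i)) e \<cdot>\<^bsub>K\<^esub> (H (P i) \<cdot>\<^bsub>K\<^esub> E i)
        = (bond c (Q d) e \<cdot>\<^bsub>K\<^esub> H d) \<cdot>\<^bsub>K\<^esub> (bond b (P i) d \<cdot>\<^bsub>K\<^esub> E i)" "Q (P i) \<le> e"
      if P: "transformation K a b (P, E)" "P i \<le> d"
        and Q: "transformation K b c (Q, H)" "Q d \<le> e" for P E Q H
    proof -
      note Pi = transD[OF P(1) i]
      note QP = transD[OF Q(1) Pi(1)] and Qd = transD[OF Q(1) d(1)]
      note le = trans_mono[OF Q(1) Pi(1) d(1) P(2)]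
      note bP = bond_hom[OF b Pi(1) d(1) P(2)]
      note bQ = bond_hom[OF c QP(1) Qd(1) le]
      note be = bond_hom[OF c Qd(1) e(1) Q(2)]
      show "Q (P i) \<le> e" using le Q(2) by simp
      have "bond c (Q (P i)) e \<cdot>\<^bsub>K\<^esub> (H (P i) \<cdot>\<^bsub>K\<^esub> E i)
          = bond c (Q d) e \<cdot>\<^bsub>K\<^esub> (bond c (Q (P i)) (Q d) \<cdot>\<^bsub>K\<^esub> (H (P i) \<cdot>\<^bsub>K\<^esub> E i))"
        using bond_bond_comp[OF c comp_hom[OF Pi(2) QP(2)] QP(1) Qd(1) e(1) le Q(2)] by simp
      also have "\<dots> = bond c (Q d) e \<cdot>\<^bsub>K\<^esub> ((bond c (Q (P i)) (Q d) \<cdot>\<^bsub>K\<^esub> H (P i)) \<cdot>\<^bsub>K\<^esub> E i)"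
        using comp_assoc[OF Pi(2) QP(2) bQ] by simp
      also have "\<dots> = bond c (Q d) e \<cdot>\<^bsub>K\<^esub> ((H d \<cdot>\<^bsub>K\<^esub> bond b (P i) d) \<cdot>\<^bsub>K\<^esub> E i)"
        using trans_nat[OF Q(1) Pi(1) d(1) P(2)] by simp
      also have "\<dots> = bond c (Q d) e \<cdot>\<^bsub>K\<^esub> (H d \<cdot>\<^bsub>K\<^esub> (bond b (P i) d \<cdot>\<^bsub>K\<^esub> E i))"
        using comp_assoc[OF Pi(2) bP Qd(2)] by simp
      also have "\<dots> = (bond c (Q d) e \<cdot>\<^bsub>K\<^esub> H d) \<cdot>\<^bsub>K\<^esub> (bond b (P i) d \<cdot>\<^bsub>K\<^esub> E i)"
        by (rule comp_assoc[OF comp_hom[OF Pi(2) bP] Qd(2) be])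
      finally show "bond c (Q (P i)) e \<cdot>\<^bsub>K\<^esub> (H (P i) \<cdot>\<^bsub>K\<^esub> E i)
        = (bond c (Q d) e \<cdot>\<^bsub>K\<^esub> H d) \<cdot>\<^bsub>K\<^esub> (bond b (P i) d \<cdot>\<^bsub>K\<^esub> E i)" .
    qed
    show ?thesis
      using step[OF ts(1) d(2) tt(1) e(2)] step[OF ts(2) d(3) tt(2) e(3)] d(4) e(1,4) by auto
  qed
  then have "pretrans_eq K a c (trans_comp K t s) (trans_comp K t' s')"
    by (simp add: eqs)
  moreover have "transformation K a c (trans_comp K t s)"
    using transformation_comp[OF a b c ts(1) tt(1)] by (simp add: eqs)
  moreover have "transformation K a c (trans_comp K t' s')"
    using transformation_comp[OF a b c ts(2) tt(2)] by (simp add: eqs)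
  ultimately show ?thesis by (simp add: trans_rel_def)
qed

lemma arrow_of_hom:
  assumes "inductive_sequence K a" "inductive_sequence K b" "transformation K a b s"
  shows "arrow_of K a b s \<in> Hom (Seq K) a b"
  using assms by (auto simp: Hom_def Seq_def arrow_of_def intro: quotientI)

lemma Seq_hom_cases:
  assumes "X \<in> Hom (Seq K) a b"
  obtains s where "inductive_sequence K a" "inductive_sequence K b" "transformation K a b s"
    "X = arrow_of K a b s"
  using assms by (auto simp: Hom_def Seq_def arrow_of_def elim!: quotientE)

lemma arrow_of_eq_iff:
  assumes "inductive_sequence K b" "transformation K a b s" "transformation K a b t"
  shows "arrow_of K a b s = arrow_of K a b t \<longleftrightarrow> pretrans_eq K a b s t"
  using eq_equiv_class_iff[OF equiv_trans_rel[OF assms(1)], of s a t] assms(2,3)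
  by (simp add: arrow_of_def trans_rel_def)

lemma Seq_comp:
  assumes a: "inductive_sequence K a" and b: "inductive_sequence K b"
    and c: "inductive_sequence K c"
    and s: "transformation K a b s" and t: "transformation K b c t"
  shows "arrow_of K b c t \<cdot>\<^bsub>Seq K\<^esub> arrow_of K a b s = arrow_of K a c (trans_comp K t s)"
proof -
  let ?r = "trans_rel K a c"
  have ss: "(s, s) \<in> trans_rel K a b" and tt: "(t, t) \<in> trans_rel K b c"
    using s t pretrans_eq_refl[OF b s] pretrans_eq_refl[OF c t] by (simp_all add: trans_rel_def)
  have "?r `` {trans_comp K t' s'} = ?r `` {trans_comp K t s}"
    if "(s, s') \<in> trans_rel K a b" "(t, t') \<in> trans_rel K b c" for s' t'
    using equiv_class_eq[OF equiv_trans_rel[OF c] trans_comp_cong[OF a b c that]] by simp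
  then have "(\<Union>t' \<in> trans_rel K b c `` {t}. \<Union>s' \<in> trans_rel K a b `` {s}.
      ?r `` {trans_comp K t' s'}) = ?r `` {trans_comp K t s}"
    using ss tt by blast
  then show ?thesis by (simp add: arrow_of_def Seq_def)
qed

lemma transformation_ide:
  assumes a: "inductive_sequence K a"
  shows "transformation K a a (\<lambda>i. i, \<lambda>i. Ide K (ob a i))"
  using ide_hom[OF seq_obj[OF a]] comp_ide_left[OF bond_hom[OF a]]
    comp_ide_right[OF bond_hom[OF a]]
  by (auto intro: mono_onI)

lemma Seq_Ide: "Ide (Seq K) a = arrow_of K a a (\<lambda>i. i, \<lambda>i. Ide K (ob a i))"
  by (simp add: Seq_def)

lemma arrow_of_cong:
  assumes "inductive_sequence K b" "transformation K a b s" "transformation K a b t"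
    and "pretrans_eq K a b s t"
  shows "arrow_of K a b s = arrow_of K a b t"
  using arrow_of_eq_iff[OF assms(1-3)] assms(4) by simp

theorem category_Seq:
  "category (Seq K :: (('i::wellorder, 'o, 'm) sequence, ('i, 'o, 'm) seq_arrow) cat)"
proof
  fix f :: "('i::wellorder, 'o, 'm) seq_arrow"
  assume f: "f \<in> Arr (Seq K)"
  then show "Dom (Seq K) f \<in> Obj (Seq K)" "Cod (Seq K) f \<in> Obj (Seq K)"
    by (auto simp: Seq_def)
next
  fix x :: "('i::wellorder, 'o, 'm) sequence"
  assume "x \<in> Obj (Seq K)"
  then have "inductive_sequence K x" by (simp add: Seq_def)
  then show "Ide (Seq K) x \<in> Hom (Seq K) x x"
    unfolding Seq_Ide by (intro arrow_of_hom transformation_ide)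
next
  fix f g :: "('i::wellorder, 'o, 'm) seq_arrow" and x y z
  assume f: "f \<in> Hom (Seq K) x y" and g: "g \<in> Hom (Seq K) y z"
  from f obtain s where s: "inductive_sequence K x" "inductive_sequence K y"
    "transformation K x y s" "f = arrow_of K x y s" by (rule Seq_hom_cases)
  from g obtain t where t: "inductive_sequence K y" "inductive_sequence K z"
    "transformation K y z t" "g = arrow_of K y z t" by (rule Seq_hom_cases)
  show "g \<cdot>\<^bsub>Seq K\<^esub> f \<in> Hom (Seq K) x z"
    using s t by (simp add: Seq_comp arrow_of_hom transformation_comp)
next
  fix f :: "('i::wellorder, 'o, 'm) seq_arrow" and x y
  assume f: "f \<in> Hom (Seq K) x y"
  then obtain s where s: "inductive_sequence K x" "inductive_sequence K y"
    "transformation K x y s" "f = arrow_of K x y s" by (rule Seq_hom_cases)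
  obtain p F where eq: "s = (p, F)" by fastforce
  note tr = s(3)[unfolded eq]
  show "f \<cdot>\<^bsub>Seq K\<^esub> Ide (Seq K) x = f"
  proof -
    have "pretrans_eq K x y (trans_comp K s (\<lambda>i. i, \<lambda>i. Ide K (ob x i))) s"
      using comp_ide_right[OF transD(2)[OF tr]] transD(1)[OF tr] by (auto simp: eq)
    then show ?thesis
      unfolding Seq_Ide s(4)
      by (rule trans[OF Seq_comp[OF s(1,1,2) transformation_ide[OF s(1)] s(3)]
            arrow_of_cong[OF s(2) transformation_comp[OF s(1,1,2) transformation_ide[OF s(1)] s(3)] s(3)]])
  qed
  show "Ide (Seq K) y \<cdot>\<^bsub>Seq K\<^esub> f = f"
  proof -
    have "pretrans_eq K x y (trans_comp K (\<lambda>i. i, \<lambda>i. Ide K (ob y i)) s) s"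
      using comp_ide_left[OF transD(2)[OF tr]] transD(1)[OF tr] by (auto simp: eq)
    then show ?thesis
      unfolding Seq_Ide s(4)
      by (rule trans[OF Seq_comp[OF s(1,2,2) s(3) transformation_ide[OF s(2)]]
            arrow_of_cong[OF s(2) transformation_comp[OF s(1,2,2) s(3) transformation_ide[OF s(2)]] s(3)]])
  qed
next
  fix f g h :: "('i::wellorder, 'o, 'm) seq_arrow" and w x y z
  assume f: "f \<in> Hom (Seq K) w x" and g: "g \<in> Hom (Seq K) x y" and h: "h \<in> Hom (Seq K) y z"
  from f obtain s where s: "inductive_sequence K w" "inductive_sequence K x"
    "transformation K w x s" "f = arrow_of K w x s" by (rule Seq_hom_cases)
  from g obtain t where t: "inductive_sequence K x" "inductive_sequence K y"
    "transformation K x y t" "g = arrow_of K x y t" by (rule Seq_hom_cases)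
  from h obtain r where r: "inductive_sequence K y" "inductive_sequence K z"
    "transformation K y z r" "h = arrow_of K y z r" by (rule Seq_hom_cases)
  obtain p F q G v H where eqs: "s = (p, F)" "t = (q, G)" "r = (v, H)"
    by (metis surj_pair)
  note tr = s(3)[unfolded eqs] t(3)[unfolded eqs] r(3)[unfolded eqs]
  have "H (q (p i)) \<cdot>\<^bsub>K\<^esub> (G (p i) \<cdot>\<^bsub>K\<^esub> F i) = (H (q (p i)) \<cdot>\<^bsub>K\<^esub> G (p i)) \<cdot>\<^bsub>K\<^esub> F i"
    and "v (q (p i)) \<in> idx z" if "i \<in> idx w" for i
  proof -
    note 1 = transD[OF tr(1) that]
    note 2 = transD[OF tr(2) 1(1)]
    note 3 = transD[OF tr(3) 2(1)]
    show "H (q (p i)) \<cdot>\<^bsub>K\<^esub> (G (p i) \<cdot>\<^bsub>K\<^esub> F i) = (H (q (p i)) \<cdot>\<^bsub>K\<^esub> G (p i)) \<cdot>\<^bsub>K\<^esub> F i"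
      by (rule comp_assoc[OF 1(2) 2(2) 3(2)])
    show "v (q (p i)) \<in> idx z" by (rule 3(1))
  qed
  then have "pretrans_eq K w z (trans_comp K r (trans_comp K t s))
      (trans_comp K (trans_comp K r t) s)"
    by (auto simp: eqs)
  then have "arrow_of K w z (trans_comp K r (trans_comp K t s))
      = arrow_of K w z (trans_comp K (trans_comp K r t) s)"
    by (intro arrow_of_cong r(2)
        transformation_comp[OF s(1) t(1,2) s(3) t(3), THEN transformation_comp[OF s(1) r(1,2) _ r(3)]]
        transformation_comp[OF s(1,2) r(2) s(3) transformation_comp[OF t(1) r(1,2) t(3) r(3)]])
  then show "h \<cdot>\<^bsub>Seq K\<^esub> (g \<cdot>\<^bsub>Seq K\<^esub> f) = (h \<cdot>\<^bsub>Seq K\<^esub> g) \<cdot>\<^bsub>Seq K\<^esub> f"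
    unfolding s(4) t(4) r(4) using s(1-3) t(1-3) r(1-3)
    by (simp add: Seq_comp transformation_comp)
qed

lemma inductive_sequence_obj_seq:
  assumes "x \<in> Obj K"
  shows "inductive_sequence K (obj_seq K x :: ('i::wellorder, 'o, 'm) sequence)"
proof -
  have "j = (LEAST i. True)" if "j \<le> (LEAST i. True)" for j :: 'i
    using that Least_le[of "\<lambda>_. True" j] by simp
  then show ?thesis
    using assms ide_hom[OF assms] comp_ide_left[OF ide_hom[OF assms]]
    by (auto simp: inductive_sequence_def obj_seq_def)
qed

lemma arr_seq_hom:
  assumes "f \<in> Hom K x y"
  shows "arr_seq K f \<in> Hom (Seq K) (obj_seq K x) (obj_seq K y)"
proof -
  note f = HomD[OF assms]
  have x: "x \<in> Obj K" and y: "y \<in> Obj K"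
    using f dom_obj cod_obj by auto
  have "transformation K (obj_seq K x) (obj_seq K y) (\<lambda>i. i, \<lambda>_. f)"
    using assms comp_ide_left[OF assms] comp_ide_right[OF assms]
    by (auto simp: obj_seq_def mono_on_def)
  then show ?thesis
    unfolding arr_seq_def f(2,3) by (intro arrow_of_hom inductive_sequence_obj_seq x y)
qed

lemma seq_inj_hom:
  assumes "inductive_sequence K u" "k \<in> idx u"
  shows "seq_inj K u k \<in> Hom (Seq K) (obj_seq K (ob u k)) u"
proof -
  note x = seq_obj[OF assms]
  have "transformation K (obj_seq K (ob u k)) u (\<lambda>_. k, \<lambda>_. Ide K (ob u k))"
    using assms(2) ide_hom[OF x] bond_refl[OF assms]
    by (auto simp: obj_seq_def mono_on_def)
  then show ?thesis
    unfolding seq_inj_def by (intro arrow_of_hom inductive_sequence_obj_seq x assms)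
qed

end

end

theory Submission
  imports Defs
begin

text \<open>
  The proof is a back-and-forth argument. Condition (A) for \<open>u\<close> turns any arrow
  \<open>f : u\<^sub>i \<rightarrow> y\<close> into a factor of a bonding arrow \<open>u\<^sub>i \<rightarrow> u\<^sub>m\<close> with \<open>m > i\<close>: there is
  \<open>g : y \<rightarrow> u\<^sub>m\<close> with \<open>g \<circ> f\<close> equal to it (lemma \<open>fraisse_absorb\<close>). Applied to \<open>u\<close> and to
  \<open>v\<close> in turn, starting from the given arrow \<open>u\<^sub>k \<rightarrow> v\<^sub>l\<close>, this yields a zigzag
  \<open>u\<^bsub>i 0\<^esub> \<rightarrow> v\<^bsub>j 0\<^esub> \<rightarrow> u\<^bsub>i 1\<^esub> \<rightarrow> v\<^bsub>j 1\<^esub> \<rightarrow> \<dots>\<close> with \<open>i 0 = k\<close> and \<open>j 0 = l\<close>, all of whose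
  triangles commute: the composite of two consecutive arrows is a bonding arrow of \<open>u\<close> or of
  \<open>v\<close> (lemma \<open>fraisse_interleaving\<close>).

  Since the indices increase strictly, both \<open>i\<close> and \<open>j\<close> dominate the identity on the natural
  numbers, so \<open>u\<^sub>m \<rightarrow> u\<^bsub>i m\<^esub> \<rightarrow> v\<^bsub>j m\<^esub>\<close> makes sense for every \<open>m\<close> and is a transformation
  \<open>u \<rightarrow> v\<close>. The other half of the zigzag gives a transformation \<open>v \<rightarrow> u\<close>, and the composite
  \<open>u \<rightarrow> v \<rightarrow> u\<close> consists of bonding arrows of \<open>u\<close>, that is, it represents the identity
  (lemma \<open>backward_forward\<close>). The zigzag with its first arrow removed is a zigzag of the same
  kind between \<open>v\<close> and \<open>u\<close>. So the arrow \<open>v \<rightarrow> u\<close> has a left inverse as well as a right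
  inverse, which makes it and its right inverse \<open>u \<rightarrow> v\<close> isomorphisms (lemma \<open>forward_iso\<close>).

  Commutativity of the zigzag between \<open>0\<close> and \<open>k\<close> shows that the isomorphism \<open>u \<rightarrow> v\<close>
  extends the initial arrow \<open>u\<^sub>k \<rightarrow> v\<^sub>l\<close> (lemma \<open>forward_extends\<close>). That \<open>u\<close> and \<open>v\<close> are
  isomorphic follows because condition (U) for \<open>v\<close> provides an arrow from \<open>u\<^sub>0\<close> to start with.
\<close>

section \<open>Isomorphisms from interleaved sequences\<close>

lemma (in category) is_iso_if_inverse_has_left_inverse:
  assumes f: "f \<in> Hom K x y" and g: "g \<in> Hom K y x" and h: "h \<in> Hom K x y"
    and gf: "g \<cdot> f = Ide K x" and hg: "h \<cdot> g = Ide K y"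
  shows "is_iso K f"
proof -
  have "h = h \<cdot> (g \<cdot> f)"
    using gf comp_ide_right[OF h] by simp
  also have "\<dots> = f"
    using comp_assoc[OF f g h] hg comp_ide_left[OF f] by simp
  finally have "f \<cdot> g = Ide K y"
    using hg by simp
  then show ?thesis
    using HomD[OF f] g gf by (auto simp: is_iso_def)
qed

text \<open>
  The zigzag of the back-and-forth argument. The arrow \<open>g n\<close> goes to index \<open>i (Suc n)\<close>, so that
  \<open>f 0, g 0, f 1, g 1, \<dots>\<close> is the order in which the arrows follow each other.
\<close>

locale interleaving = category K
  for K :: "('o, 'm) cat" (structure) +
  fixes u v :: "(nat, 'o, 'm) sequence"
    and i j :: "nat \<Rightarrow> nat" and f g :: "nat \<Rightarrow> 'm"
  assumes u: "inductive_sequence K u" "idx u = UNIV"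
    and v: "inductive_sequence K v" "idx v = UNIV"
    and i: "strict_mono i" and j: "strict_mono j"
    and f: "f n \<in> Hom K (ob u (i n)) (ob v (j n))"
    and g: "g n \<in> Hom K (ob v (j n)) (ob u (i (Suc n)))"
    and gf: "g n \<cdot> f n = bond u (i n) (i (Suc n))"
    and fg: "f (Suc n) \<cdot> g n = bond v (j n) (j (Suc n))"
begin

lemma category: "category K" ..

lemma u_hom: "m \<le> n \<Longrightarrow> bond u m n \<in> Hom K (ob u m) (ob u n)"
  using bond_hom[OF u(1)] u(2) by simp

lemma v_hom: "m \<le> n \<Longrightarrow> bond v m n \<in> Hom K (ob v m) (ob v n)"
  using bond_hom[OF v(1)] v(2) by simp

lemma u_comp: "l \<le> m \<Longrightarrow> m \<le> n \<Longrightarrow> bond u m n \<cdot> bond u l m = bond u l n"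
  using bond_comp[OF u(1)] u(2) by simp

lemma v_comp: "l \<le> m \<Longrightarrow> m \<le> n \<Longrightarrow> bond v m n \<cdot> bond v l m = bond v l n"
  using bond_comp[OF v(1)] v(2) by simp

lemma i_le: "m \<le> n \<Longrightarrow> i m \<le> i n"
  using i by (simp add: strict_mono_less_eq)

lemma j_le: "m \<le> n \<Longrightarrow> j m \<le> j n"
  using j by (simp add: strict_mono_less_eq)

lemma le_i: "n \<le> i n"
  using i by (rule strict_mono_imp_increasing)

lemma le_j: "n \<le> j n"
  using j by (rule strict_mono_imp_increasing)

text \<open>
  Two adjacent triangles of the zigzag form a commuting square; larger squares are
  pasted together from these.
\<close>

lemma f_natural:
  assumes "m \<le> n"
  shows "f n \<cdot> bond u (i m) (i n) = bond v (j m) (j n) \<cdot> f m"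
  using assms
proof (induction n rule: dec_induct)
  case base
  have "ob u (i m) \<in> Obj K" "ob v (j m) \<in> Obj K"
    using seq_obj[OF u(1)] seq_obj[OF v(1)] u(2) v(2) by auto
  then show ?case
    using comp_ide_right[OF f] comp_ide_left[OF f] bond_refl[OF u(1)] bond_refl[OF v(1)] u(2) v(2)
    by simp
next
  case (step n)
  note i_mn = i_le[OF step(1)] and j_mn = j_le[OF step(1)]
  have i_n: "i n \<le> i (Suc n)" and j_n: "j n \<le> j (Suc n)"
    by (simp_all add: i_le j_le)
  have square: "f (Suc n) \<cdot> bond u (i n) (i (Suc n)) = bond v (j n) (j (Suc n)) \<cdot> f n"
    using comp_assoc[OF f g f, of n] gf[of n] fg[of n] by simp
  have "f (Suc n) \<cdot> bond u (i m) (i (Suc n))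
      = (f (Suc n) \<cdot> bond u (i n) (i (Suc n))) \<cdot> bond u (i m) (i n)"
    using comp_assoc[OF u_hom[OF i_mn] u_hom[OF i_n] f] u_comp[OF i_mn i_n] by simp
  also have "\<dots> = bond v (j n) (j (Suc n)) \<cdot> (f n \<cdot> bond u (i m) (i n))"
    using comp_assoc[OF u_hom[OF i_mn] f v_hom[OF j_n]] square by simp
  also have "\<dots> = bond v (j m) (j (Suc n)) \<cdot> f m"
    using comp_assoc[OF f v_hom[OF j_mn] v_hom[OF j_n]] v_comp[OF j_mn j_n] step.IH by simp
  finally show ?case .
qed

text \<open>
  The bonding arrow in front extends the family \<open>f\<close>, given at the indices \<open>i m\<close> only, to all
  indices \<open>m\<close>.
\<close>

definition forward :: "(nat, 'm) pretrans" where
  "forward = (j, \<lambda>m. f m \<cdot> bond u m (i m))"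

definition backward :: "(nat, 'm) pretrans" where
  "backward = (\<lambda>m. i (Suc m), \<lambda>m. g m \<cdot> bond v m (j m))"

lemma transformation_forward: "transformation K u v forward"
proof -
  have "(f n \<cdot> bond u n (i n)) \<cdot> bond u m n = bond v (j m) (j n) \<cdot> (f m \<cdot> bond u m (i m))"
    if mn: "m \<le> n" for m n
  proof -
    note bonds = u_hom[OF mn] u_hom[OF le_i, of n] u_hom[OF le_i, of m] u_hom[OF i_le[OF mn]]
    have "(f n \<cdot> bond u n (i n)) \<cdot> bond u m n = f n \<cdot> bond u m (i n)"
      using comp_assoc[OF bonds(1,2) f] u_comp[OF mn le_i] by simp
    also have "\<dots> = (f n \<cdot> bond u (i m) (i n)) \<cdot> bond u m (i m)"
      using comp_assoc[OF bonds(3,4) f] u_comp[OF le_i i_le[OF mn]] by simp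
    also have "\<dots> = bond v (j m) (j n) \<cdot> (f m \<cdot> bond u m (i m))"
      using comp_assoc[OF bonds(3) f v_hom[OF j_le[OF mn]]] f_natural[OF mn] by simp
    finally show ?thesis .
  qed
  moreover have "f m \<cdot> bond u m (i m) \<in> Hom K (ob u m) (ob v (j m))" for m
    using comp_hom[OF u_hom[OF le_i] f] .
  ultimately show ?thesis
    using v(2) j_le by (auto simp: forward_def intro: mono_onI)
qed

text \<open>
  Dropping the first arrow \<open>f 0\<close> of the zigzag exchanges the roles of \<open>u\<close> and \<open>v\<close>. The
  \<open>forward\<close> transformation of the new zigzag is the \<open>backward\<close> one of the old, so each fact
  about \<open>u \<rightarrow> v\<close> also gives its counterpart about \<open>v \<rightarrow> u\<close>.
\<close>

lemma interleaving_shift: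
  "interleaving K v u j (\<lambda>n. i (Suc n)) g (\<lambda>n. f (Suc n))"
  using i j by unfold_locales (auto simp: u v j f g gf fg strict_mono_def)

lemma forward_shift:
  "interleaving.forward K v j (\<lambda>n. i (Suc n)) g = backward"
  using interleaving.forward_def[OF interleaving_shift] by (simp add: backward_def)

lemma transformation_backward: "transformation K v u backward"
  using interleaving.transformation_forward[OF interleaving_shift] forward_shift by simp

text \<open>
  The component at \<open>m\<close> of the composite passes through \<open>v\<^bsub>j m\<^esub>\<close>. Sliding \<open>f m\<close> along the bonding
  arrow \<open>v\<^bsub>j m\<^esub> \<rightarrow> v\<^bsub>j (j m)\<^esub>\<close> makes it adjacent to \<open>g (j m)\<close>, and the two cancel to a bonding
  arrow of \<open>u\<close>. Every component is then a bonding arrow, hence equivalent to an identity.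
\<close>

lemma backward_forward:
  "arrow_of K v u backward \<cdot>\<^bsub>Seq K\<^esub> arrow_of K u v forward = Ide (Seq K) u"
proof -
  have comp: "(g (j m) \<cdot> bond v (j m) (j (j m))) \<cdot> (f m \<cdot> bond u m (i m))
      = bond u m (i (Suc (j m)))" for m
  proof -
    let ?n = "j m"
    have i_mn: "i m \<le> i ?n" and i_n: "i ?n \<le> i (Suc ?n)" and m_n: "m \<le> i ?n"
      using i_le[OF le_j] i_le[of ?n "Suc ?n"] order_trans[OF le_i i_le[OF le_j]] by auto
    note u_m = u_hom[OF le_i, of m]
    have "(g ?n \<cdot> bond v (j m) (j ?n)) \<cdot> (f m \<cdot> bond u m (i m))
        = g ?n \<cdot> (bond v (j m) (j ?n) \<cdot> (f m \<cdot> bond u m (i m)))"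
      using comp_assoc[OF comp_hom[OF u_m f] v_hom[OF j_le[OF le_j]] g] by simp
    also have "\<dots> = g ?n \<cdot> ((f ?n \<cdot> bond u (i m) (i ?n)) \<cdot> bond u m (i m))"
      using comp_assoc[OF u_m f v_hom[OF j_le[OF le_j]]] f_natural[OF le_j] by simp
    also have "\<dots> = g ?n \<cdot> (f ?n \<cdot> bond u m (i ?n))"
      using comp_assoc[OF u_m u_hom[OF i_mn] f] u_comp[OF le_i i_mn] by simp
    also have "\<dots> = bond u m (i (Suc ?n))"
      using comp_assoc[OF u_hom[OF m_n] f g] gf u_comp[OF m_n i_n] by simp
    finally show ?thesis .
  qed
  have m_le: "m \<le> i (Suc (j m))" for m
    using le_i[of "Suc (j m)"] le_j[of m] by linarith
  have refl: "bond u n n = Ide K (ob u n)" for n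
    using bond_refl[OF u(1)] u(2) by simp
  have "bond u (i (Suc (j m))) (i (Suc (j m))) \<cdot> bond u m (i (Suc (j m)))
      = bond u m (i (Suc (j m))) \<cdot> Ide K (ob u m)" for m
    using comp_ide_left[OF u_hom[OF m_le]] comp_ide_right[OF u_hom[OF m_le]] refl by simp
  then have "pretrans_eq K u u (trans_comp K backward forward) (\<lambda>m. m, \<lambda>m. Ide K (ob u m))"
    unfolding backward_def forward_def trans_comp.simps pretrans_eq.simps comp comp_def u(2)
    using m_le by blast
  then have "arrow_of K u u (trans_comp K backward forward) = Ide (Seq K) u"
    unfolding Seq_Ide[OF category]
    by (intro arrow_of_cong[OF category u(1)]
        transformation_comp[OF category u(1) v(1) u(1) transformation_forward
          transformation_backward]
        transformation_ide[OF category u(1)])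
  then show ?thesis
    using Seq_comp[OF category u(1) v(1) u(1) transformation_forward transformation_backward]
    by simp
qed

lemma forward_iso: "is_iso (Seq K) (arrow_of K u v forward)"
proof -
  interpret shift: interleaving K v u j "\<lambda>n. i (Suc n)" g "\<lambda>n. f (Suc n)"
    by (rule interleaving_shift)
  \<comment> \<open>The third arrow, \<open>shift.backward\<close>, has components built from the arrows \<open>f (Suc n)\<close>. It differs
    from \<open>forward\<close> as a transformation, but is a left inverse of \<open>backward\<close>.\<close>
  show ?thesis
  proof (rule category.is_iso_if_inverse_has_left_inverse[OF category_Seq[OF category]])
    show "arrow_of K u v forward \<in> Hom (Seq K) u v"
      by (rule arrow_of_hom[OF category u(1) v(1) transformation_forward])
    show "arrow_of K v u backward \<in> Hom (Seq K) v u"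
      by (rule arrow_of_hom[OF category v(1) u(1) transformation_backward])
    show "arrow_of K u v shift.backward \<in> Hom (Seq K) u v"
      by (rule arrow_of_hom[OF category u(1) v(1) shift.transformation_backward])
    show "arrow_of K v u backward \<cdot>\<^bsub>Seq K\<^esub> arrow_of K u v forward = Ide (Seq K) u"
      by (rule backward_forward)
    show "arrow_of K u v shift.backward \<cdot>\<^bsub>Seq K\<^esub> arrow_of K v u backward = Ide (Seq K) v"
      using shift.backward_forward by (simp add: forward_shift)
  qed
qed

text \<open>
  The component of \<open>forward\<close> at \<open>i 0\<close> ends at \<open>v\<^bsub>j (i 0)\<^esub>\<close> rather than at \<open>v\<^bsub>j 0\<^esub>\<close>;
  \<open>f_natural\<close> between \<open>0\<close> and \<open>i 0\<close> identifies it with \<open>f 0\<close> followed by a bonding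
  arrow of \<open>v\<close>.
\<close>

lemma forward_extends:
  "arrow_of K u v forward \<cdot>\<^bsub>Seq K\<^esub> seq_inj K u (i 0) = seq_inj K v (j 0) \<cdot>\<^bsub>Seq K\<^esub> arr_seq K (f 0)"
proof -
  let ?x = "ob u (i 0)" and ?y = "ob v (j 0)"
  let ?a = "obj_seq K ?x :: (nat, 'o, 'm) sequence"
  let ?b = "obj_seq K ?y :: (nat, 'o, 'm) sequence"
  let ?k = "(\<lambda>_. i 0, \<lambda>_. Ide K ?x) :: (nat, 'm) pretrans"
  let ?l = "(\<lambda>_. j 0, \<lambda>_. Ide K ?y) :: (nat, 'm) pretrans"
  let ?f = "(\<lambda>n. n, \<lambda>_. f 0) :: (nat, 'm) pretrans"
  have x: "?x \<in> Obj K" and y: "?y \<in> Obj K"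
    using seq_obj[OF u(1)] seq_obj[OF v(1)] u(2) v(2) by auto
  note a = inductive_sequence_obj_seq[OF category x, where 'i = nat]
  note b = inductive_sequence_obj_seq[OF category y, where 'i = nat]
  have refl: "bond u n n = Ide K (ob u n)" "bond v n n = Ide K (ob v n)" for n
    using bond_refl[OF u(1)] bond_refl[OF v(1)] u(2) v(2) by auto
  have k: "transformation K ?a u ?k" and l: "transformation K ?b v ?l"
    using u(2) v(2) ide_hom[OF x] ide_hom[OF y] refl by (auto simp: obj_seq_def mono_on_def)
  have f0: "transformation K ?a ?b ?f"
    using f comp_ide_left[OF f] comp_ide_right[OF f] by (auto simp: obj_seq_def mono_on_def)
  let ?c = "j (i 0)"
  have F: "f (i 0) \<cdot> bond u (i 0) (i (i 0)) \<in> Hom K ?x (ob v ?c)"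
    using comp_hom[OF u_hom[OF le_i] f] .
  have "bond v ?c ?c \<cdot> ((f (i 0) \<cdot> bond u (i 0) (i (i 0))) \<cdot> Ide K ?x)
      = f (i 0) \<cdot> bond u (i 0) (i (i 0))"
    using comp_ide_right[OF F] comp_ide_left[OF F] refl by simp
  also have "\<dots> = bond v (j 0) ?c \<cdot> (Ide K ?y \<cdot> f 0)"
    using f_natural[of 0 "i 0"] comp_ide_left[OF f] by simp
  finally have "pretrans_eq K ?a v (trans_comp K forward ?k) (trans_comp K ?l ?f)"
    using v(2) j_le[of 0 "i 0"] by (auto simp: forward_def)
  then have "arrow_of K ?a v (trans_comp K forward ?k) = arrow_of K ?a v (trans_comp K ?l ?f)"
    by (intro arrow_of_cong[OF category v(1)]
        transformation_comp[OF category a u(1) v(1) k transformation_forward]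
        transformation_comp[OF category a b v(1) f0 l])
  then show ?thesis
    using Seq_comp[OF category a u(1) v(1) k transformation_forward]
      Seq_comp[OF category a b v(1) f0 l] HomD[OF f[of 0]]
    by (simp add: seq_inj_def arr_seq_def)
qed

end

section \<open>Back and forth between Fraisse sequences\<close>

text \<open>
  Condition (A) with a strictly larger index: composing with one more bonding arrow is
  harmless, and it makes the indices of the zigzag increase strictly.
\<close>

lemma fraisse_absorb:
  assumes "category K" and "omega_fraisse K u" and f: "f \<in> Hom K (ob u n) y"
  shows "\<exists>m > n. \<exists>g \<in> Hom K y (ob u m). g \<cdot>\<^bsub>K\<^esub> f = bond u n m"
proof -
  interpret category K by fact
  have u: "inductive_sequence K u" "idx u = UNIV"
    using assms(2) by (auto simp: omega_fraisse_def)
  obtain m h where m: "n \<le> m" and h: "h \<in> Hom K y (ob u m)" "bond u n m = h \<cdot>\<^bsub>K\<^esub> f"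
    using assms(2) f unfolding omega_fraisse_def by blast
  have b: "bond u m (Suc m) \<in> Hom K (ob u m) (ob u (Suc m))"
    using bond_hom[OF u(1)] u(2) by simp
  have "(bond u m (Suc m) \<cdot>\<^bsub>K\<^esub> h) \<cdot>\<^bsub>K\<^esub> f = bond u n (Suc m)"
    using comp_assoc[OF f h(1) b] h(2) bond_comp[OF u(1), of n m "Suc m"] u(2) m by simp
  then show ?thesis
    using comp_hom[OF h(1) b] m by (intro exI[of _ "Suc m"]) auto
qed

lemma fraisse_interleaving:
  fixes K :: "('o, 'm) cat"
  assumes K: "category K" and u: "omega_fraisse K u" and v: "omega_fraisse K v"
    and f0: "f0 \<in> Hom K (ob u k) (ob v l)"
  obtains i j f g where "interleaving K u v i j f g" "i 0 = k" "j 0 = l" "f 0 = f0"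
proof -
  \<comment> \<open>A state \<open>(i, j, f)\<close> is one arrow \<open>f : u\<^sub>i \<rightarrow> v\<^sub>j\<close> of the zigzag; \<open>?Q\<close> relates it to the
    next such arrow through some \<open>g : v\<^sub>j \<rightarrow> u\<^bsub>i'\<^esub>\<close> closing both triangles.\<close>
  let ?P = "\<lambda>n (i, j, f). f \<in> Hom K (ob u i) (ob v j) \<and>
    (n = (0::nat) \<longrightarrow> (i, j, f) = (k, l, f0))"
  let ?g = "\<lambda>(i, j, f) (i', j', f') g. g \<in> Hom K (ob v j) (ob u i') \<and>
    g \<cdot>\<^bsub>K\<^esub> f = bond u i i' \<and> f' \<cdot>\<^bsub>K\<^esub> g = bond v j j'"
  let ?Q = "\<lambda>n::nat. \<lambda>(i, j, f) (i', j', f'). i < i' \<and> j < j' \<and>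
    (\<exists>g. ?g (i, j, f) (i', j', f') g)"
  have start: "\<exists>x. ?P 0 x"
    using f0 by auto
  have "\<exists>y. ?P (Suc n) y \<and> ?Q n x y" if x_P: "?P n x" for x n
  proof -
    obtain i j f where x: "x = (i, j, f)" by (metis surj_pair)
    have f: "f \<in> Hom K (ob u i) (ob v j)" using x_P x by simp
    obtain i' g where i': "i < i'" "g \<in> Hom K (ob v j) (ob u i')" "g \<cdot>\<^bsub>K\<^esub> f = bond u i i'"
      using fraisse_absorb[OF K u f] by blast
    obtain j' f' where j': "j < j'" "f' \<in> Hom K (ob u i') (ob v j')" "f' \<cdot>\<^bsub>K\<^esub> g = bond v j j'"
      using fraisse_absorb[OF K v i'(2)] by blast
    show ?thesis
      using x i' j' by (intro exI[of _ "(i', j', f')"]) auto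
  qed
  from dependent_nat_choice[of ?P ?Q, OF start this]
  obtain s where "\<forall>n. ?P n (s n) \<and> ?Q n (s n) (s (Suc n))" ..
  then have s: "?P n (s n)" "?Q n (s n) (s (Suc n))" for n
    by simp_all
  define i j f where "i = (\<lambda>n. fst (s n))" and "j = (\<lambda>n. fst (snd (s n)))"
    and "f = (\<lambda>n. snd (snd (s n)))"
  have s_eq: "s n = (i n, j n, f n)" for n
    by (simp add: i_def j_def f_def)
  have "\<exists>g. ?g (i n, j n, f n) (i (Suc n), j (Suc n), f (Suc n)) g" for n
    using s(2)[of n] by (simp add: s_eq)
  then have "\<forall>n. \<exists>g. ?g (i n, j n, f n) (i (Suc n), j (Suc n), f (Suc n)) g" ..
  from choice[OF this]
  obtain g where g: "\<forall>n. ?g (i n, j n, f n) (i (Suc n), j (Suc n), f (Suc n)) (g n)" ..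
  interpret category K by (fact K)
  have "interleaving K u v i j f g"
  proof
    show "inductive_sequence K u" "idx u = UNIV" "inductive_sequence K v" "idx v = UNIV"
      using u v by (auto simp: omega_fraisse_def)
    show "strict_mono i" "strict_mono j"
      using s(2) by (auto simp: strict_mono_Suc_iff s_eq)
  qed (use s(1) g in \<open>auto simp: s_eq\<close>)
  moreover have "i 0 = k" "j 0 = l" "f 0 = f0"
    using s(1)[of 0] by (auto simp: s_eq)
  ultimately show ?thesis
    by (rule that)
qed

theorem theorem3p15:
  fixes K :: "('o, 'm) cat"
    and u v :: "(nat, 'o, 'm) sequence"
  assumes "category K"
    and "omega_fraisse K u"
    and "omega_fraisse K v"
  shows "(\<forall>k l. \<forall>f \<in> Hom K (ob u k) (ob v l).
            \<exists>F \<in> Hom (Seq K) u v. is_iso (Seq K) F \<and>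
              F \<cdot>\<^bsub>Seq K\<^esub> seq_inj K u k = seq_inj K v l \<cdot>\<^bsub>Seq K\<^esub> arr_seq K f)
         \<and> isomorphic (Seq K) u v"
proof -
  have ext: "\<exists>F \<in> Hom (Seq K) u v. is_iso (Seq K) F \<and>
      F \<cdot>\<^bsub>Seq K\<^esub> seq_inj K u k = seq_inj K v l \<cdot>\<^bsub>Seq K\<^esub> arr_seq K f0"
    if f0: "f0 \<in> Hom K (ob u k) (ob v l)" for k l f0
  proof -
    obtain i j f g where "interleaving K u v i j f g" and start: "i 0 = k" "j 0 = l" "f 0 = f0"
      using fraisse_interleaving[OF assms f0] .
    then interpret interleaving K u v i j f g by simp
    show ?thesis
      using arrow_of_hom[OF assms(1) u(1) v(1) transformation_forward] forward_iso
        forward_extends[unfolded start]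
      by blast
  qed
  have "ob u 0 \<in> Obj K"
    using assms(2) by (auto simp: omega_fraisse_def inductive_sequence_def)
  \<comment> \<open>Condition (U) for \<open>v\<close> supplies an arrow to start from.\<close>
  then obtain l f0 where "f0 \<in> Hom K (ob u 0) (ob v l)"
    using assms(3) unfolding omega_fraisse_def by blast
  from ext[OF this] show ?thesis
    using ext unfolding isomorphic_def by blast
qed

end
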